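(* Let $\{X_i\}_{i\in\mathbb{N}}$ be a stochastic process of real random variables (not assumed independent), all having the same distribution, with density $f$. Suppose $f$ has support $[a,b]$ (that is, $f(x)=0$ for all $x\notin[a,b]$) and $\rho_f:=\int_{\mathbb{R}} f^2(x)\,dx<\infty$. Define $\rho=\log\big((b-a)\rho_f\big)$. Suppose the query parameter $q$ follows the same probability distribution as the keys $X_i$. Then there is a procedure $R_n$ for building learned indexes such that $\overline{S}_n=O(n)$ and $\overline{T}_n=O(\rho)$. That is, for an array $A$ with $n$ keys an index can be built with space overhead $O(n)$ and expected query time $O(\rho)$. Since $\rho$ is independent of $n$, expected time is asymptotically $O(1)$.
   Context: Keys and rank. For each $n$, $X_{(1)}\le\dots\le X_{(n)}$ denote $X_1,\dots,X_n$ sorted in ascending order, and $A=[X_{(1)},\dots,X_{(n)}]$ is the sorted array of keys. For $q\in\mathbb{R}$, $\mathrm{rank}_A(q)=\sum_{i=1}^n \mathbf{1}_{X_{(i)}\le q}$. Answering the query $q$ means computing $\mathrm{rank}_A(q)$ exactly. Model of computation. Random Access Machine under the uniform cost criterion: each instruction takes one unit of time and each register (stored value) uses one unit of space. Space overhead counts only the redundant space introduced by the index, not the storage of $A$ itself; the time needed to build (train) the index is not counted. Indexes. For each $n$, $R_n$ is a procedure that takes the sorted array $A$ of $n$ keys as input and outputs an index structure $R_n(A)$. $S(R_n(A))$ is the space overhead of $R_n(A)$, and $T(R_n(A),q)$ is the query time for $q$ over $A$ when using $R_n(A)$. Set $\overline{S}_n=\sup_{A=[X_{(1)},\dots,X_{(n)}]}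 S(R_n(A))$ and $\overline{T}_n=\mathbb{E}[T(R_n(A),q)]$, where the expectation is taken over the realizations of the stochastic process and the choice of query.
   Formalization: The bound O(ρ) on expected query time is asserted only for ρ > 0, since it fails for the uniform density (ρ = 0, yet a query takes at least one step); in all cases expected time at most C(1+ρ) with universal C, and O(1), is proved. *)

theory Defs
  imports "HOL-Probability.Probability" "HOL-Library.Landau_Symbols"
begin

text \<open>
  A random access machine with real registers and unit costs. It has random access to two read-only
  arrays, the keys and the table of the index, and a bank of directly addressed work registers.
  A register used as an array address is rounded down; there is no other rounding operation, so
  rounding is useful only up to the array lengths and cannot be used to unpack a register that
  encodes many values.
\<close>

datatype instr =
    Const nat real
  | Copy nat nat
  | Add nat nat nat
  | Sub nat nat nat
  | Mul nat nat nat
  | Div nat nat nat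
  | LoadKey nat nat
  | LoadTable nat nat
  | Jump nat
  | JumpLe nat nat nat

record index =
  code :: "instr list"
  table :: "real list"

type_synonym config = "nat \<times> (nat \<Rightarrow> real)"

definition read :: "real list \<Rightarrow> real \<Rightarrow> real" where
  "read xs x = (let k = nat \<lfloor>x\<rfloor> in if k < length xs then xs ! k else 0)"

fun exec :: "real list \<Rightarrow> real list \<Rightarrow> instr \<Rightarrow> config \<Rightarrow> config" where
  "exec A D (Const i c) (pc, r) = (Suc pc, r(i := c))"
| "exec A D (Copy i j) (pc, r) = (Suc pc, r(i := r j))"
| "exec A D (Add i j k) (pc, r) = (Suc pc, r(i := r j + r k))"
| "exec A D (Sub i j k) (pc, r) = (Suc pc, r(i := r j - r k))"
| "exec A D (Mul i j k) (pc, r) = (Suc pc, r(i := r j * r k))"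
| "exec A D (Div i j k) (pc, r) = (Suc pc, r(i := r j / r k))"
| "exec A D (LoadKey i j) (pc, r) = (Suc pc, r(i := read A (r j)))"
| "exec A D (LoadTable i j) (pc, r) = (Suc pc, r(i := read D (r j)))"
| "exec A D (Jump l) (pc, r) = (l, r)"
| "exec A D (JumpLe j k l) (pc, r) = (if r j \<le> r k then l else Suc pc, r)"

definition halted :: "index \<Rightarrow> config \<Rightarrow> bool" where
  "halted I c \<longleftrightarrow> length (code I) \<le> fst c"

definition step :: "index \<Rightarrow> real list \<Rightarrow> config \<Rightarrow> config" where
  "step I A c = (if halted I c then c else exec A (table I) (code I ! fst c) c)"

text \<open>The query is passed in register 0 and the number of keys in register 1.\<close>

definition start :: "real list \<Rightarrow> real \<Rightarrow> config" where
  "start A q = (0, (\<lambda>_. 0)(0 := q, 1 := real (length A)))"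

definition after :: "index \<Rightarrow> real list \<Rightarrow> real \<Rightarrow> nat \<Rightarrow> config" where
  "after I A q t = (step I A ^^ t) (start A q)"

definition key_rank :: "real list \<Rightarrow> real \<Rightarrow> nat" where
  "key_rank A q = (\<Sum>i<length A. of_bool (A ! i \<le> q))"

text \<open>The answer is returned in register 0.\<close>

definition answers :: "index \<Rightarrow> real list \<Rightarrow> real \<Rightarrow> bool" where
  "answers I A q \<longleftrightarrow>
     (\<exists>t. halted I (after I A q t) \<and> snd (after I A q t) 0 = real (key_rank A q))"

text \<open>Only meaningful if the computation halts, as it does whenever \<^term>\<open>answers I A q\<close> holds.\<close>

definition query_time :: "index \<Rightarrow> real list \<Rightarrow> real \<Rightarrow> nat" where
  "query_time I A q = (LEAST t. halted I (after I A q t))"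

text \<open>
  An instruction names at most three work registers, so counting the code also accounts, up to a
  constant factor, for the work space of a query.
\<close>

definition space_overhead :: "index \<Rightarrow> nat" where
  "space_overhead I = length (code I) + length (table I)"

definition arrays :: "nat \<Rightarrow> real list set" where
  "arrays n = {A. sorted A \<and> length A = n}"

text \<open>
  The query algorithm is a single program, used for all \<open>n\<close> and all arrays; only the table depends
  on them. The construction of the table is an arbitrary function, because it is not charged for.
\<close>

definition index_procedure :: "(nat \<Rightarrow> real list \<Rightarrow> index) \<Rightarrow> bool" where
  "index_procedure R \<longleftrightarrow>
     (\<exists>P. \<forall>n. \<forall>A\<in>arrays n. code (R n A) = P) \<and>
     (\<forall>n. \<forall>A\<in>arrays n. \<forall>q. answers (R n A) A q)"

definition sup_space :: "(nat \<Rightarrow> real list \<Rightarrow> index) \<Rightarrow> nat \<Rightarrow> real" where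
  "sup_space R n = (SUP A\<in>arrays n. real (space_overhead (R n A)))"

definition sorted_keys :: "(nat \<Rightarrow> 'a \<Rightarrow> real) \<Rightarrow> nat \<Rightarrow> 'a \<Rightarrow> real list" where
  "sorted_keys X n \<omega> = sort (map (\<lambda>i. X i \<omega>) [0..<n])"

definition random_query_time ::
  "(nat \<Rightarrow> 'a \<Rightarrow> real) \<Rightarrow> (nat \<Rightarrow> real list \<Rightarrow> index) \<Rightarrow> nat \<Rightarrow> 'a \<times> real \<Rightarrow> real" where
  "random_query_time X R n = (\<lambda>(\<omega>, q).
     real (query_time (R n (sorted_keys X n \<omega>)) (sorted_keys X n \<omega>) q))"

text \<open>
  The expectation is over the realizations of the process \<open>X\<close> on \<open>M\<close> and the choice of a query with
  law \<open>Q\<close>; the query is chosen independently of the keys.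
\<close>

definition expected_time ::
  "'a measure \<Rightarrow> (nat \<Rightarrow> 'a \<Rightarrow> real) \<Rightarrow> real measure \<Rightarrow>
     (nat \<Rightarrow> real list \<Rightarrow> index) \<Rightarrow> nat \<Rightarrow> real" where
  "expected_time M X Q R n = (LINT z|(M \<Otimes>\<^sub>M Q). random_query_time X R n z)"

definition rho :: "real \<Rightarrow> real \<Rightarrow> (real \<Rightarrow> real) \<Rightarrow> real" where
  "rho a b f = ln ((b - a) * (LINT x|lborel. (f x)\<^sup>2))"

end

theory Submission
  imports Defs "HOL-Library.Log_Nat"
begin

text \<open>
  Cut \<open>[a,b]\<close> into \<open>n\<close> cells of equal width and tabulate how many keys precede each cell; a query
  then only searches among the \<open>w\<close> keys of its own cell, by bisection in time \<open>O(1 + log (1 + w))\<close>.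
  By linearity of expectation, which needs no independence of the keys, the mean of \<open>w\<close> is \<open>n\<close> times
  the probability that a key and an independent query share a cell, and this is at most
  \<open>s = (b - a) * \<integral> f\<^sup>2\<close>. The tangent of the logarithm at \<open>s \<ge> 1\<close> turns this into
  expected time \<open>O(1 + log s)\<close>.
\<close>

section \<open>The index\<close>

text \<open>Correctness is demanded for every sorted array and every real query, so the coordinate
  is clamped and points outside \<open>[a,b]\<close> go to the end cells. The value \<open>n\<close>
  is attained at \<open>b\<close>, so there are \<open>n + 1\<close> cells.\<close>

definition cell :: "real \<Rightarrow> real \<Rightarrow> nat \<Rightarrow> real \<Rightarrow> nat" where
  "cell a b n x = nat \<lfloor>max 0 (min (real n) ((x - a) * real n / (b - a)))\<rfloor>"

text \<open>
  Registers: 4 holds the current lower bound for the rank, 5 the width \<open>w\<close> of the remaining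
  interval, 6 its half, 7 is never written and hence 0, 8 the offset \<open>n + 2\<close> of the halves in the
  table, which replace the missing rounding operation. Instructions 16 to 26 are the bisection.
  It leaves width \<open>w div 2\<close> on both branches, which also take equally many steps, so that the
  query time is a function of the query and the initial \<open>w\<close> only; this makes it easy to show
  measurable.
\<close>

definition query_code :: "real \<Rightarrow> real \<Rightarrow> instr list" where
  "query_code a b =
    [Const 2 a, Sub 2 0 2, Mul 2 2 1, Const 3 (b - a), Div 2 2 3,
     JumpLe 2 1 7, Copy 2 1, JumpLe 7 2 9, Copy 2 7,
     LoadTable 4 2, Const 3 1, Add 2 2 3, LoadTable 5 2, Sub 5 5 4, Add 8 1 3, Add 8 8 3,
     JumpLe 5 7 27, Add 2 8 5, LoadTable 6 2, Add 2 4 6, LoadKey 2 2, Sub 5 5 6,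
     JumpLe 2 0 24, Jump 25, Add 4 4 5, Copy 5 6, Jump 16,
     Copy 0 4]"

text \<open>Counts run up to \<open>k = n + 1\<close> because cell \<open>n\<close> is delimited by
  entries \<open>n\<close> and \<open>n + 1\<close>. The halves for \<open>w = 0, ..., n\<close>
  then start at address \<open>n + 2\<close>.\<close>

definition rank_table :: "real \<Rightarrow> real \<Rightarrow> nat \<Rightarrow> real list \<Rightarrow> real list" where
  "rank_table a b n A =
     map (\<lambda>k. real (length (filter (\<lambda>x. cell a b n x < k) A))) [0..<n + 2] @
     map (\<lambda>w. real (w div 2)) [0..<n + 1]"

definition cell_index :: "real \<Rightarrow> real \<Rightarrow> nat \<Rightarrow> real list \<Rightarrow> index" where
  "cell_index a b n A = \<lparr>code = query_code a b, table = rank_table a b n A\<rparr>"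

lemma cell_le: "cell a b n x \<le> n"
proof -
  have "\<lfloor>max 0 (min (real n) ((x - a) * real n / (b - a)))\<rfloor> \<le> int n"
    by (simp add: floor_le_iff)
  then show ?thesis
    by (simp add: cell_def)
qed

lemma cell_mono:
  assumes "a < b" "x \<le> y"
  shows "cell a b n x \<le> cell a b n y"
  using assms unfolding cell_def
  by (intro nat_mono floor_mono max.mono min.mono divide_right_mono mult_right_mono) auto

lemma cell_measurable [measurable]: "cell a b n \<in> borel \<rightarrow>\<^sub>M count_space UNIV"
  unfolding cell_def by measurable

lemma length_query_code: "length (query_code a b) = 28"
  by (simp add: query_code_def numeral_eq_Suc)

lemma space_cell_index: "space_overhead (cell_index a b n A) = 2 * n + 31"
  by (simp add: space_overhead_def cell_index_def length_query_code rank_table_def)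

section \<open>Ranks in a sorted array and counts per cell\<close>

lemma key_rank_conv: "key_rank A q = length (filter (\<lambda>x. x \<le> q) A)"
  by (simp add: key_rank_def length_filter_conv_card of_bool_def sum.If_cases Int_def)

text \<open>In a sorted array the positions of the keys at most \<open>q\<close> form an initial
  segment, whose cardinality is the rank. This lets a single key comparison decide a bisection
  step.\<close>

lemma sorted_nth_le_iff:
  assumes "sorted A" "i < length A"
  shows "A ! i \<le> q \<longleftrightarrow> i < key_rank A q"
proof -
  define S where "S = {j. j < length A \<and> A ! j \<le> q}"
  have fin: "finite S" and rank: "key_rank A q = card S"
    by (auto simp: S_def key_rank_conv length_filter_conv_card)
  show ?thesis
  proof
    assume "A ! i \<le> q"
    then have "{..i} \<subseteq> S"
      using assms by (auto simp: S_def intro: order_trans[OF sorted_nth_mono])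
    from card_mono[OF fin this] show "i < key_rank A q"
      by (simp add: rank)
  next
    assume "i < key_rank A q"
    show "A ! i \<le> q"
    proof (rule ccontr)
      assume "\<not> A ! i \<le> q"
      have "j < i" if "j \<in> S" for j
      proof (rule ccontr)
        assume "\<not> j < i"
        then have "A ! i \<le> A ! j"
          using assms that by (intro sorted_nth_mono) (auto simp: S_def)
        with \<open>\<not> A ! i \<le> q\<close> that show False
          by (simp add: S_def)
      qed
      then have "S \<subseteq> {..<i}"
        by auto
      from card_mono[OF _ this] show False
        using \<open>i < key_rank A q\<close> by (simp add: rank)
    qed
  qed
qed

lemma length_filter_less_Suc:
  "length (filter (\<lambda>x. g x < Suc k) A)
     = length (filter (\<lambda>x. g x < k) A) + length (filter (\<lambda>x. g x = k) A)"
  by (induction A) auto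

lemma length_filter_mono:
  assumes "\<And>x. x \<in> set A \<Longrightarrow> P x \<Longrightarrow> Q x"
  shows "length (filter P A) \<le> length (filter Q A)"
  using assms by (induction A) auto

definition cell_size :: "real \<Rightarrow> real \<Rightarrow> nat \<Rightarrow> real list \<Rightarrow> real \<Rightarrow> nat" where
  "cell_size a b n A q = length (filter (\<lambda>x. cell a b n x = cell a b n q) A)"

text \<open>By monotonicity of \<open>cell\<close>, a key in an earlier cell is below
  \<open>q\<close>, and a key at most \<open>q\<close> is in no later cell.\<close>

lemma key_rank_cell_bounds:
  fixes a b q n A
  assumes "a < b"
  defines "lo \<equiv> length (filter (\<lambda>x. cell a b n x < cell a b n q) A)"
  shows "lo \<le> key_rank A q" "key_rank A q \<le> lo + cell_size a b n A q"
proof -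
  show "lo \<le> key_rank A q"
    unfolding lo_def key_rank_conv
    by (intro length_filter_mono) (meson cell_mono[OF \<open>a < b\<close>] linorder_not_le nle_le)
  have "key_rank A q \<le> length (filter (\<lambda>x. cell a b n x < Suc (cell a b n q)) A)"
    unfolding key_rank_conv
    by (intro length_filter_mono) (simp add: less_Suc_eq_le cell_mono[OF \<open>a < b\<close>])
  then show "key_rank A q \<le> lo + cell_size a b n A q"
    by (simp add: length_filter_less_Suc lo_def cell_size_def)
qed

lemma read_table_count:
  assumes "nat \<lfloor>x\<rfloor> = k" "k \<le> n + 1"
  shows "read (rank_table a b n A) x = real (length (filter (\<lambda>x. cell a b n x < k) A))"
  using assms by (simp add: read_def rank_table_def nth_append del: upt_Suc)

lemma read_table_half:
  assumes "w \<le> n"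
  shows "read (rank_table a b n A) (real n + 2 + real w) = real (w div 2)"
proof -
  have "nat \<lfloor>real n + 2 + real w\<rfloor> = n + 2 + w"
    by linarith
  then show ?thesis
    using assms by (simp add: read_def rank_table_def nth_append Let_def del: upt_Suc)
qed

lemma step_cell_index:
  "pc < 28 \<Longrightarrow> step (cell_index a b n A) A (pc, r)
     = exec A (rank_table a b n A) (query_code a b ! pc) (pc, r)"
  by (simp add: step_def halted_def cell_index_def length_query_code)

lemma halted_cell_index: "halted (cell_index a b n A) c \<longleftrightarrow> 28 \<le> fst c"
  by (simp add: halted_def cell_index_def length_query_code)

section \<open>Running a query\<close>

lemma funpow_numeral_apply: "(f ^^ numeral k) c = (f ^^ pred_numeral k) (f c)"
  by (simp add: numeral_eq_Suc funpow_swap1)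

text \<open>One round of bisection, the loop invariant being that the rank lies between
  \<open>lo\<close> and \<open>lo + w\<close>. Both branches of the comparison take 10
  instructions.\<close>

lemma search_iteration:
  fixes a b A n
  defines "I \<equiv> cell_index a b n A"
  assumes "sorted A" "length A = n"
    and r: "r 0 = q" "r 4 = real lo" "r 5 = real w" "r 7 = 0" "r 8 = real n + 2"
    and lo: "lo \<le> key_rank A q" "key_rank A q \<le> lo + w" "lo + w \<le> n" and "0 < w"
  obtains r' lo' where "(step I A ^^ 10) (16, r) = (16, r')"
    "r' 0 = q" "r' 4 = real lo'" "r' 5 = real (w div 2)" "r' 7 = 0" "r' 8 = real n + 2"
    "lo' \<le> key_rank A q" "key_rank A q \<le> lo' + w div 2" "lo' + w div 2 \<le> n"
proof -
  define m where "m = lo + w div 2"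
  have m: "m < n"
    using lo \<open>0 < w\<close> by (simp add: m_def)
  have key: "read A (real lo + real (w div 2)) = A ! m"
  proof -
    have "nat \<lfloor>real lo + real (w div 2)\<rfloor> = m"
      unfolding m_def by linarith
    then show ?thesis
      using m \<open>length A = n\<close> by (simp add: read_def)
  qed
  have half: "read (rank_table a b n A) (real n + 2 + real w) = real (w div 2)"
    using lo by (intro read_table_half) simp
  have le: "A ! m \<le> q \<longleftrightarrow> m < key_rank A q"
    using m assms by (intro sorted_nth_le_iff) auto
  \<comment> \<open>If \<open>A ! m \<le> q\<close>, the rank is at least \<open>m + 1\<close>. The
    new bound is exactly \<open>m + 1\<close> for odd \<open>w\<close>, but only \<open>m\<close>
    for even \<open>w\<close>; this slack makes the remaining width \<open>w div 2\<close> in both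
    branches.\<close>
  define lo' where "lo' = (if A ! m \<le> q then lo + (w - w div 2) else lo)"
  define r' where "r' = snd ((step I A ^^ 10) (16, r))"
  have run: "(step I A ^^ 10) (16, r) = (16, r') \<and>
    r' 0 = q \<and> r' 4 = real lo' \<and> r' 5 = real (w div 2) \<and> r' 7 = 0 \<and> r' 8 = real n + 2"
    using r \<open>0 < w\<close> unfolding r'_def I_def lo'_def
    by (cases "A ! m \<le> q")
      (simp_all add: funpow_numeral_apply step_cell_index query_code_def key half of_nat_diff)
  show ?thesis
    using run that[of r' lo'] lo le by (auto simp: lo'_def m_def split: if_splits)
qed

text \<open>Halving removes one binary digit of \<open>w\<close>, so there are
  \<open>floorlog 2 w\<close> rounds, and one more jump leaves the loop. At width 0 the invariant
  forces \<open>lo\<close> to be the rank.\<close>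

lemma binary_search_run:
  fixes a b A n
  defines "I \<equiv> cell_index a b n A"
  assumes "sorted A" "length A = n"
    and "r 0 = q" "r 4 = real lo" "r 5 = real w" "r 7 = 0" "r 8 = real n + 2"
    and "lo \<le> key_rank A q" "key_rank A q \<le> lo + w" "lo + w \<le> n"
  shows "\<exists>r'. (step I A ^^ (10 * floorlog 2 w + 1)) (16, r) = (27, r') \<and> r' 4 = real (key_rank A q)"
  using assms(4-)
proof (induction w arbitrary: r lo rule: less_induct)
  case (less w)
  show ?case
  proof (cases "w = 0")
    case True
    with less.prems show ?thesis
      by (auto simp: I_def step_cell_index query_code_def floorlog_def)
  next
    case False
    obtain r' lo' where run: "(step I A ^^ 10) (16, r) = (16, r')"
      and r': "r' 0 = q" "r' 4 = real lo'" "r' 5 = real (w div 2)" "r' 7 = 0" "r' 8 = real n + 2"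
        "lo' \<le> key_rank A q" "key_rank A q \<le> lo' + w div 2" "lo' + w div 2 \<le> n"
      using search_iteration[OF assms(2,3) less.prems, where a = a and b = b] False by (auto simp: I_def)
    have "10 * floorlog 2 w + 1 = (10 * floorlog 2 (w div 2) + 1) + 10"
      using False by (subst compute_floorlog) simp
    then show ?thesis
      using less.IH[OF _ r'] False run by (simp only: funpow_add o_apply)
  qed
qed

text \<open>The 16 consists of 14 preparatory instructions, the jump out of the loop and the final
  copy. Each clamp costs one extra instruction when it takes effect.\<close>

definition cell_query_time :: "real \<Rightarrow> real \<Rightarrow> nat \<Rightarrow> real list \<Rightarrow> real \<Rightarrow> nat" where
  "cell_query_time a b n A q =
     16 + of_bool (real n < (q - a) * real n / (b - a)) + of_bool ((q - a) * real n / (b - a) < 0)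
     + 10 * floorlog 2 (cell_size a b n A q)"

lemma prefix_run:
  fixes a b A n q
  defines "I \<equiv> cell_index a b n A" and "x \<equiv> (q - a) * real n / (b - a)"
  assumes "length A = n"
  shows "\<exists>r. (step I A ^^ (14 + of_bool (real n < x) + of_bool (x < 0))) (start A q) = (16, r) \<and>
    r 0 = q \<and> r 4 = real (length (filter (\<lambda>x. cell a b n x < cell a b n q) A)) \<and>
    r 5 = real (cell_size a b n A q) \<and> r 7 = 0 \<and> r 8 = real n + 2"
proof -
  \<comment> \<open>The content of register 2 after clamping, still unrounded: only the table access
    takes the floor, so \<open>y\<close> and \<open>y + 1\<close> address the two counts that
    delimit the cell.\<close>
  define y where "y = max 0 (min (real n) x)"
  have y: "nat \<lfloor>y\<rfloor> = cell a b n q" "nat \<lfloor>y + 1\<rfloor> = Suc (cell a b n q)"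
    unfolding y_def x_def cell_def by (simp_all add: nat_add_distrib)
  have t: "read (rank_table a b n A) y = real (length (filter (\<lambda>x. cell a b n x < cell a b n q) A))"
    "read (rank_table a b n A) (y + 1) = real (length (filter (\<lambda>x. cell a b n x < Suc (cell a b n q)) A))"
    using cell_le[of a b n q] by (auto intro!: read_table_count y)
  consider "real n < x" "y = real n" | "x < 0" "y = 0" | "0 \<le> x" "x \<le> real n" "y = x"
    unfolding y_def by linarith
  note cases = this
  note run = funpow_numeral_apply step_cell_index query_code_def start_def I_def length_filter_less_Suc
    cell_size_def \<open>length A = n\<close> x_def[symmetric]
  from cases show ?thesis
  proof cases
    case 1
    then have "\<not> x < 0"
      by linarith
    with 1 t show ?thesis
      by (simp add: run)
  next
    case 2
    then have "\<not> real n < x"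
      by linarith
    with 2 t show ?thesis
      by (simp add: run)
  next
    case 3
    then have "\<not> real n < x" "\<not> x < 0"
      by simp_all
    with 3 t show ?thesis
      by (simp add: run)
  qed
qed

lemma funpow_step_halted: "halted I c \<Longrightarrow> (step I A ^^ t) c = c"
  by (induction t) (simp_all add: step_def)

text \<open>Since halted configurations are fixed points of \<open>step\<close>, not being halted at
  \<open>T - 1\<close> excludes every earlier halt, so \<open>T\<close> is the exact query
  time.\<close>

lemma cell_index_run:
  fixes a b A n q
  defines "I \<equiv> cell_index a b n A" and "T \<equiv> cell_query_time a b n A q"
  assumes "a < b" "A \<in> arrays n"
  shows "halted I (after I A q T)" "snd (after I A q T) 0 = real (key_rank A q)"
    "\<not> halted I (after I A q (T - 1))"
proof -
  define lo where "lo = length (filter (\<lambda>x. cell a b n x < cell a b n q) A)"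
  define t where "t = (14 + of_bool (real n < (q - a) * real n / (b - a))
    + of_bool ((q - a) * real n / (b - a) < 0) :: nat)"
  define w where "w = cell_size a b n A q"
  have A: "sorted A" "length A = n"
    using \<open>A \<in> arrays n\<close> by (simp_all add: arrays_def)
  have "lo + w \<le> n"
    using length_filter_le[of "\<lambda>x. cell a b n x < Suc (cell a b n q)" A]
    by (simp add: lo_def w_def cell_size_def length_filter_less_Suc A)
  obtain r where r: "(step I A ^^ t) (start A q) = (16, r)"
    "r 0 = q" "r 4 = real lo" "r 5 = real w" "r 7 = 0" "r 8 = real n + 2"
    using prefix_run[OF A(2), where a = a and b = b and q = q] by (auto simp: I_def t_def lo_def w_def)
  obtain r' where r': "(step I A ^^ (10 * floorlog 2 w + 1)) (16, r) = (27, r')"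
    "r' 4 = real (key_rank A q)"
    using binary_search_run[OF A r(2-), where a = a and b = b]
      key_rank_cell_bounds[OF \<open>a < b\<close>, where n = n and q = q and A = A]
      \<open>lo + w \<le> n\<close>
    by (auto simp: I_def lo_def w_def)
  have split: "T - 1 = (10 * floorlog 2 w + 1) + t"
    by (simp add: T_def cell_query_time_def t_def w_def)
  then have before: "after I A q (T - 1) = (27, r')"
    by (simp only: after_def split funpow_add[of "10 * floorlog 2 w + 1"] o_apply r r')
  have "T = Suc (T - 1)"
    by (simp add: T_def cell_query_time_def)
  then have "after I A q T = step I A (after I A q (T - 1))"
    unfolding after_def by (metis funpow.simps(2) o_apply)
  then have after: "after I A q T = (28, r'(0 := r' 4))"
    unfolding before by (simp add: I_def step_cell_index query_code_def)
  show "halted I (after I A q T)" "snd (after I A q T) 0 = real (key_rank A q)"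
    "\<not> halted I (after I A q (T - 1))"
    unfolding after before by (simp_all add: I_def halted_cell_index r')
qed

lemma answers_cell_index:
  "a < b \<Longrightarrow> A \<in> arrays n \<Longrightarrow> answers (cell_index a b n A) A q"
  using cell_index_run unfolding answers_def by blast

lemma query_time_cell_index:
  assumes "a < b" "A \<in> arrays n"
  shows "query_time (cell_index a b n A) A q = cell_query_time a b n A q"
  unfolding query_time_def
proof (rule Least_equality)
  let ?I = "cell_index a b n A" and ?T = "cell_query_time a b n A q"
  show "halted ?I (after ?I A q ?T)"
    by (rule cell_index_run[OF assms])
  fix t assume halt: "halted ?I (after ?I A q t)"
  show "?T \<le> t"
  proof (rule ccontr)
    assume "\<not> ?T \<le> t"
    then have "?T - 1 = (?T - 1 - t) + t"
      by simp
    then have "after ?I A q (?T - 1) = (step ?I A ^^ (?T - 1 - t)) (after ?I A q t)"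
      unfolding after_def by (metis funpow_add o_apply)
    with halt have "halted ?I (after ?I A q (?T - 1))"
      by (simp only: funpow_step_halted)
    with cell_index_run(3)[OF assms] show False
      by blast
  qed
qed

section \<open>Expected query time\<close>

lemma length_filter_sorted_keys:
  "length (filter P (sorted_keys X n \<omega>)) = (\<Sum>i<n. of_bool (P (X i \<omega>)))"
  unfolding sorted_keys_def filter_sort length_sort
  by (induction n) auto

lemma sorted_keys_arrays: "sorted_keys X n \<omega> \<in> arrays n"
  by (simp add: arrays_def sorted_keys_def)

text \<open>The size of the query's cell as a function on the product space. It counts over the
  unsorted keys, so measurability and linearity of expectation apply without treating the sorted
  array as a random variable.\<close>

definition collisions :: "real \<Rightarrow> real \<Rightarrow> (nat \<Rightarrow> 'a \<Rightarrow> real) \<Rightarrow> nat \<Rightarrow> 'a \<times> real \<Rightarrow> nat" where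
  "collisions a b X n = (\<lambda>(\<omega>, q). \<Sum>i<n. of_bool (cell a b n (X i \<omega>) = cell a b n q))"

lemma random_query_time_cell_index:
  assumes "a < b"
  shows "random_query_time X (cell_index a b) n = (\<lambda>z. 16
    + of_bool (real n < (snd z - a) * real n / (b - a)) + of_bool ((snd z - a) * real n / (b - a) < 0)
    + 10 * real (floorlog 2 (collisions a b X n z)))"
  by (auto simp: random_query_time_def query_time_cell_index[OF assms sorted_keys_arrays]
      cell_query_time_def cell_size_def length_filter_sorted_keys collisions_def fun_eq_iff)

lemma index_procedure_cell_index: "a < b \<Longrightarrow> index_procedure (cell_index a b)"
  unfolding index_procedure_def using answers_cell_index by (auto simp: cell_index_def)

lemma sup_space_cell_index: "sup_space (cell_index a b) n = 2 * real n + 31"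
proof -
  \<comment> \<open>The supremum of a constant is that constant only over a nonempty set.\<close>
  have "replicate n 0 \<in> arrays n"
    by (simp add: arrays_def)
  then have "arrays n \<noteq> {}"
    by blast
  then show ?thesis
    by (simp add: sup_space_def space_cell_index)
qed

section \<open>Measure of a cell and the collision integral\<close>

lemma pred_eq_nat [measurable (raw)]:
  fixes f g :: "'a \<Rightarrow> nat"
  assumes [measurable]: "f \<in> M \<rightarrow>\<^sub>M count_space UNIV" "g \<in> M \<rightarrow>\<^sub>M count_space UNIV"
  shows "Measurable.pred M (\<lambda>x. f x = g x)"
proof -
  have "{x \<in> space M. real (f x) = real (g x)} \<in> sets M"
    by (intro borel_measurable_eq) measurable
  then show ?thesis
    by (simp add: pred_def)
qed

text \<open>Inside \<open>[a,b]\<close> the clamp has no effect, so cell \<open>k\<close> lies in an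
  interval of length \<open>d\<close>. The restriction matters, since the clamped end cells are
  unbounded.\<close>

lemma cell_width:
  assumes "a < b" "0 < n"
  shows "emeasure lborel {x \<in> {a..b}. cell a b n x = k} \<le> ennreal ((b - a) / real n)"
proof -
  define d where "d = (b - a) / real n"
  have "0 < d"
    using assms by (simp add: d_def)
  have "{x \<in> {a..b}. cell a b n x = k} \<subseteq> {a + real k * d .. a + real k * d + d}"
  proof
    fix x assume "x \<in> {x \<in> {a..b}. cell a b n x = k}"
    then have x: "x \<in> {a..b}" "k = cell a b n x"
      by auto
    define y where "y = (x - a) * real n / (b - a)"
    have "0 \<le> y" "y \<le> real n"
      using x assms mult_right_mono[of "x - a" "b - a" "real n"]
      by (auto simp: y_def field_simps)
    then have "k = nat \<lfloor>y\<rfloor>"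
      by (simp add: x cell_def y_def)
    then have "real k \<le> y" "y \<le> real k + 1"
      using \<open>0 \<le> y\<close> by linarith+
    then have "real k * d \<le> y * d" "y * d \<le> (real k + 1) * d"
      using \<open>0 < d\<close> by simp_all
    moreover have "y * d = x - a"
      using assms by (simp add: y_def d_def)
    ultimately show "x \<in> {a + real k * d .. a + real k * d + d}"
      by (simp add: algebra_simps)
  qed
  from emeasure_mono[OF this, of lborel] show ?thesis
    using \<open>0 < d\<close> by (simp add: d_def)
qed

text \<open>AM-GM replaces \<open>f x * f y\<close> by squares, after which one of the two variables only
  contributes the length of a cell.\<close>

lemma collision_integral_le:
  fixes f :: "real \<Rightarrow> real" and c :: "real \<Rightarrow> nat"
  assumes [measurable]: "f \<in> borel_measurable borel" "c \<in> borel \<rightarrow>\<^sub>M count_space UNIV" "S \<in> sets borel"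
    and nonneg: "\<And>x. 0 \<le> f x" and supp: "\<And>x. x \<notin> S \<Longrightarrow> f x = 0"
    and width: "\<And>k. emeasure lborel {x \<in> S. c x = k} \<le> d"
  shows "(\<integral>\<^sup>+x. \<integral>\<^sup>+y. ennreal (f x) * (ennreal (f y) * of_bool (c y = c x)) \<partial>lborel \<partial>lborel)
    \<le> d * (\<integral>\<^sup>+x. ennreal ((f x)\<^sup>2) \<partial>lborel)" (is "?L \<le> d * ?R")
proof -
  \<comment> \<open>The collision indicator restricted to \<open>S\<close>. It is symmetric, and
    each of its sections has measure at most \<open>d\<close>.\<close>
  define J :: "real \<Rightarrow> real \<Rightarrow> ennreal"
    where "J x y = (if x \<in> S \<and> y \<in> S \<and> c x = c y then 1 else 0)" for x y
  have J [measurable]: "(\<lambda>z. J (fst z) (snd z)) \<in> borel_measurable (borel \<Otimes>\<^sub>M borel)"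
    unfolding J_def by measurable
  have J' [measurable]: "J x \<in> borel_measurable borel" for x
    unfolding J_def by measurable
  have J_sym: "J x y = J y x" for x y
    by (auto simp: J_def)
  have J_int: "(\<integral>\<^sup>+y. J x y \<partial>lborel) \<le> d" for x
  proof -
    have "(\<integral>\<^sup>+y. J x y \<partial>lborel) \<le> (\<integral>\<^sup>+y. indicator {y \<in> S. c y = c x} y \<partial>lborel)"
      by (intro nn_integral_mono) (auto simp: J_def indicator_def)
    also have "\<dots> \<le> d"
      using width[of "c x"] by (subst nn_integral_indicator) auto
    finally show ?thesis .
  qed
  have sq: "(\<integral>\<^sup>+x. \<integral>\<^sup>+y. ennreal ((f x)\<^sup>2) * J x y \<partial>lborel \<partial>lborel) \<le> d * ?R"
  proof -
    have "(\<integral>\<^sup>+y. ennreal ((f x)\<^sup>2) * J x y \<partial>lborel) \<le> d * ennreal ((f x)\<^sup>2)" for x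
      using J_int[of x] by (subst nn_integral_cmult) (auto simp: mult.commute[of d] intro: mult_left_mono)
    then have "(\<integral>\<^sup>+x. \<integral>\<^sup>+y. ennreal ((f x)\<^sup>2) * J x y \<partial>lborel \<partial>lborel)
        \<le> (\<integral>\<^sup>+x. d * ennreal ((f x)\<^sup>2) \<partial>lborel)"
      by (intro nn_integral_mono)
    then show ?thesis
      by (simp add: nn_integral_cmult)
  qed
  \<comment> \<open>Tonelli and the symmetry of \<open>J\<close> make the two square terms of AM-GM
    equal.\<close>
  have swap: "(\<integral>\<^sup>+x. \<integral>\<^sup>+y. ennreal ((f y)\<^sup>2) * J x y \<partial>lborel \<partial>lborel)
    = (\<integral>\<^sup>+x. \<integral>\<^sup>+y. ennreal ((f x)\<^sup>2) * J x y \<partial>lborel \<partial>lborel)"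
    by (subst lborel_pair.Fubini'[symmetric]) (simp_all add: J_sym)
  have "2 * (ennreal (f x) * (ennreal (f y) * of_bool (c y = c x)))
    \<le> ennreal ((f x)\<^sup>2) * J x y + ennreal ((f y)\<^sup>2) * J x y" for x y
  proof (cases "x \<in> S \<and> y \<in> S \<and> c y = c x")
    case True
    have "2 * (f x * f y) \<le> (f x)\<^sup>2 + (f y)\<^sup>2"
      using sum_squares_bound[of "f x" "f y"] by simp
    from ennreal_leI[OF this] True show ?thesis
      by (simp add: J_def ennreal_mult nonneg)
  next
    case False
    then show ?thesis
      using supp[of x] supp[of y] by auto
  qed
  then have "2 * ?L \<le> (\<integral>\<^sup>+x. \<integral>\<^sup>+y. ennreal ((f x)\<^sup>2) * J x y + ennreal ((f y)\<^sup>2) * J x y \<partial>lborel \<partial>lborel)"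
    by (subst nn_integral_cmult[symmetric], measurable)+ (intro nn_integral_mono, simp)
  also have "\<dots> = (\<integral>\<^sup>+x. \<integral>\<^sup>+y. ennreal ((f x)\<^sup>2) * J x y \<partial>lborel \<partial>lborel)
    + (\<integral>\<^sup>+x. \<integral>\<^sup>+y. ennreal ((f y)\<^sup>2) * J x y \<partial>lborel \<partial>lborel)"
    by (simp add: nn_integral_add)
  also have "\<dots> \<le> 2 * (d * ?R)"
    using add_mono[OF sq sq] by (simp add: swap mult_2)
  finally show ?thesis
    by (subst (asm) ennreal_mult_le_mult_iff) auto
qed

text \<open>The factor 2 is a bound for \<open>1 / ln 2\<close>, as \<open>ln 2\<close> is at least
  2/3. The shift to \<open>1 + w\<close> covers empty cells.\<close>

lemma floorlog_le_ln: "real (floorlog 2 w) \<le> 1 + 2 * ln (1 + real w)"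
proof (cases "w = 0")
  case False
  have "real (floorlog 2 w) \<le> 1 + log 2 w"
    using False by (simp add: floorlog_def)
  also have "log 2 w \<le> 2 * ln w"
  proof -
    have "ln w * 1 \<le> ln w * (2 * ln 2)"
      using False ln2_ge_two_thirds by (intro mult_left_mono) auto
    then show ?thesis
      by (simp add: log_def field_simps)
  qed
  also have "ln w \<le> ln (1 + real w)"
    using False by simp
  finally show ?thesis
    by simp
qed (simp add: floorlog_def)

text \<open>This takes the place of Jensen's inequality: the right side is affine in
  \<open>x\<close>, so its expectation needs only an upper bound on the mean of
  \<open>x\<close>.\<close>

lemma ln_le_tangent:
  fixes s x :: real
  assumes "0 < s" "0 < x"
  shows "ln x \<le> ln s + x / s - 1"
  using ln_le_minus_one[of "x / s"] assms by (simp add: ln_div)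
lemma collisions_le: "collisions a b X n z \<le> n"
  using sum_bounded_above[of "{..<n}" "\<lambda>i. of_bool (cell a b n (X i (fst z)) = cell a b n (snd z))" "1::nat"]
  by (simp add: collisions_def case_prod_beta)

section \<open>Keys and queries with a common density\<close>

locale key_process = prob_space M for M :: "'a measure" +
  fixes X :: "nat \<Rightarrow> 'a \<Rightarrow> real" and f :: "real \<Rightarrow> real" and a b :: real
  assumes f_nonneg: "0 \<le> f x"
    and X_distributed: "distributed M lborel (X i) (\<lambda>x. ennreal (f x))"
    and f_support: "x \<notin> {a..b} \<Longrightarrow> f x = 0"
    and f_square_integrable: "integrable lborel (\<lambda>x. (f x)\<^sup>2)"
begin

abbreviation query_law :: "real measure" where
  "query_law \<equiv> density lborel (\<lambda>x. ennreal (f x))"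

lemma f_measurable [measurable]: "f \<in> borel_measurable borel"
  using distributed_real_measurable[OF _ X_distributed] f_nonneg by simp

lemma X_measurable [measurable]: "X i \<in> borel_measurable M"
  using distributed_measurable[OF X_distributed] by simp

lemma prob_space_query_law: "prob_space query_law"
  using prob_space_distr[OF distributed_measurable[OF X_distributed[of 0]]]
  by (simp add: distributed_distr_eq_density[OF X_distributed])

lemma pair_prob_space_query_law: "pair_prob_space M query_law"
  using prob_space_query_law prob_space_axioms
  by (simp add: pair_prob_space_def pair_sigma_finite_def prob_space_imp_sigma_finite)

lemma nn_integral_f: "(\<integral>\<^sup>+x. ennreal (f x) \<partial>lborel) = 1"
  using prob_space.emeasure_space_1[OF prob_space_query_law] by (simp add: emeasure_density)

abbreviation collision_bound :: real where
  "collision_bound \<equiv> (b - a) * (LINT x|lborel. (f x)\<^sup>2)"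

lemma nn_integral_f_square:
  "(\<integral>\<^sup>+x. ennreal ((f x)\<^sup>2) \<partial>lborel) = ennreal (LINT x|lborel. (f x)\<^sup>2)"
  by (rule nn_integral_eq_integral[OF f_square_integrable]) simp

text \<open>The collision bound for a single cell.\<close>

lemma mass_le: "1 \<le> emeasure lborel {a..b} * ennreal (LINT x|lborel. (f x)\<^sup>2)"
proof -
  \<comment> \<open>With the constant cell map all points collide, so the left side is the squared
    total mass of \<open>f\<close>, which is 1.\<close>
  have "(\<integral>\<^sup>+x. \<integral>\<^sup>+y. ennreal (f x) * (ennreal (f y) * of_bool ((0::nat) = 0)) \<partial>lborel \<partial>lborel)
      \<le> emeasure lborel {a..b} * (\<integral>\<^sup>+x. ennreal ((f x)\<^sup>2) \<partial>lborel)"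
    by (rule collision_integral_le[where S = "{a..b}"]) (use f_nonneg f_support in \<open>auto intro!: emeasure_mono\<close>)
  then show ?thesis
    by (simp add: nn_integral_cmult nn_integral_f nn_integral_f_square)
qed

text \<open>A degenerate interval has measure zero and could not carry the mass 1.\<close>

lemma a_less_b: "a < b"
proof (rule ccontr)
  assume "\<not> a < b"
  then have "emeasure lborel {a..b} = 0"
    by (cases "a = b") auto
  with mass_le show False
    by simp
qed

lemma collision_bound_ge_1: "1 \<le> collision_bound"
  using mass_le a_less_b by (simp flip: ennreal_mult'' ennreal_1)

lemma collisions_measurable [measurable]:
  "collisions a b X n \<in> M \<Otimes>\<^sub>M query_law \<rightarrow>\<^sub>M count_space UNIV"
  unfolding collisions_def of_bool_def case_prod_beta by measurable

text \<open>In the product measure the key is integrated out first for a fixed query. This uses only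
  the marginal law of \<open>X i\<close> and leads to the collision integral with cells of width
  \<open>(b - a) / n\<close>.\<close>

lemma nn_integral_collision_le:
  assumes "0 < n"
  shows "(\<integral>\<^sup>+z. of_bool (cell a b n (X i (fst z)) = cell a b n (snd z)) \<partial>(M \<Otimes>\<^sub>M query_law))
    \<le> ennreal (collision_bound / real n)"
proof -
  interpret pair_prob_space M query_law
    by (rule pair_prob_space_query_law)
  let ?C = "\<lambda>x y. of_bool (cell a b n x = cell a b n y) :: ennreal"
  have C_measurable [measurable]: "(\<lambda>x. ?C x y) \<in> borel_measurable borel" for y
    unfolding of_bool_def by measurable
  have "(\<integral>\<^sup>+z. ?C (X i (fst z)) (snd z) \<partial>(M \<Otimes>\<^sub>M query_law))
      = (\<integral>\<^sup>+q. \<integral>\<^sup>+\<omega>. ?C (X i \<omega>) q \<partial>M \<partial>query_law)"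
    by (subst nn_integral_snd[symmetric]) (simp_all add: of_bool_def)
  also have "\<dots> = (\<integral>\<^sup>+q. \<integral>\<^sup>+x. ennreal (f x) * ?C x q \<partial>lborel \<partial>query_law)"
    by (intro nn_integral_cong distributed_nn_integral[OF X_distributed, symmetric]) simp
  also have "\<dots> = (\<integral>\<^sup>+q. ennreal (f q) * (\<integral>\<^sup>+x. ennreal (f x) * ?C x q \<partial>lborel) \<partial>lborel)"
    by (subst nn_integral_density) (simp_all add: of_bool_def)
  also have "\<dots> = (\<integral>\<^sup>+q. \<integral>\<^sup>+x. ennreal (f q) * (ennreal (f x) * ?C x q) \<partial>lborel \<partial>lborel)"
    by (simp add: nn_integral_cmult)
  also have "\<dots> \<le> ennreal ((b - a) / real n) * (\<integral>\<^sup>+x. ennreal ((f x)\<^sup>2) \<partial>lborel)"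
    by (rule collision_integral_le[where S = "{a..b}"])
      (use f_nonneg f_support cell_width[OF a_less_b assms] in auto)
  also have "\<dots> = ennreal (collision_bound / real n)"
    using a_less_b by (simp add: nn_integral_f_square flip: ennreal_mult')
  finally show ?thesis .
qed

lemma integrable_collisions: "integrable (M \<Otimes>\<^sub>M query_law) (\<lambda>z. real (collisions a b X n z))"
proof -
  interpret pair_prob_space M query_law
    by (rule pair_prob_space_query_law)
  show ?thesis
  proof (rule P.integrable_const_bound[where B = "real n"])
    show "AE z in M \<Otimes>\<^sub>M query_law. norm (real (collisions a b X n z)) \<le> real n"
      by (simp add: collisions_le)
  qed measurable
qed

text \<open>Each of the \<open>n\<close> keys contributes at most
  \<open>collision_bound / n\<close>, so the bound does not grow with \<open>n\<close>.\<close>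

lemma expectation_collisions_le:
  "(LINT z|(M \<Otimes>\<^sub>M query_law). real (collisions a b X n z)) \<le> collision_bound"
proof (cases "n = 0")
  case True
  then show ?thesis
    using collision_bound_ge_1 by (simp add: collisions_def case_prod_beta)
next
  case False
  let ?E = "LINT z|(M \<Otimes>\<^sub>M query_law). real (collisions a b X n z)"
  have "ennreal ?E = (\<integral>\<^sup>+z. ennreal (real (collisions a b X n z)) \<partial>(M \<Otimes>\<^sub>M query_law))"
    by (rule nn_integral_eq_integral[OF integrable_collisions, symmetric]) simp
  also have "\<dots> = (\<integral>\<^sup>+z. (\<Sum>i<n. of_bool (cell a b n (X i (fst z)) = cell a b n (snd z))) \<partial>(M \<Otimes>\<^sub>M query_law))"
    by (subst ennreal_of_nat_eq_real_of_nat[symmetric]) (simp add: collisions_def case_prod_beta)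
  also have "\<dots> = (\<Sum>i<n. \<integral>\<^sup>+z. of_bool (cell a b n (X i (fst z)) = cell a b n (snd z)) \<partial>(M \<Otimes>\<^sub>M query_law))"
    by (rule nn_integral_sum) (simp add: of_bool_def)
  also have "\<dots> \<le> (\<Sum>i<n. ennreal (collision_bound / real n))"
    using False by (intro sum_mono nn_integral_collision_le) simp
  also have "\<dots> = ennreal collision_bound"
    using False collision_bound_ge_1 by (simp add: ennreal_of_nat_eq_real_of_nat flip: ennreal_mult')
  finally show ?thesis
    using collision_bound_ge_1 by (subst (asm) ennreal_le_iff) auto
qed

lemma rho_nonneg: "0 \<le> rho a b f"
  using collision_bound_ge_1 by (simp add: rho_def)

lemma integrable_random_query_time:
  "integrable (M \<Otimes>\<^sub>M query_law) (random_query_time X (cell_index a b) n)"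
proof -
  interpret pair_prob_space M query_law
    by (rule pair_prob_space_query_law)
  show ?thesis
    unfolding random_query_time_cell_index[OF a_less_b]
  \<comment> \<open>The 18 is 16 plus the two clamping instructions, and a cell holds at most
    \<open>n\<close> keys.\<close>
  proof (rule P.integrable_const_bound[where B = "18 + 10 * real (floorlog 2 n)"])
    have "norm (16 + of_bool P + of_bool P' + 10 * real (floorlog 2 (collisions a b X n z)))
        \<le> 18 + 10 * real (floorlog 2 n)" for P P' z
      using floorlog_mono[OF collisions_le, of 2 a b X n z] by simp
    then show "AE z in M \<Otimes>\<^sub>M query_law. norm (16
        + of_bool (real n < (snd z - a) * real n / (b - a)) + of_bool ((snd z - a) * real n / (b - a) < 0)
        + 10 * real (floorlog 2 (collisions a b X n z))) \<le> 18 + 10 * real (floorlog 2 n)"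
      by blast
  qed measurable
qed

lemma expected_time_le: "expected_time M X query_law (cell_index a b) n \<le> 48 * (1 + rho a b f)"
proof -
  interpret pair_prob_space M query_law
    by (rule pair_prob_space_query_law)
  let ?s = collision_bound
  let ?w = "\<lambda>z. real (collisions a b X n z)"
  have s: "1 \<le> ?s"
    by (rule collision_bound_ge_1)
  have "random_query_time X (cell_index a b) n z \<le> 28 + 20 * (ln ?s + (1 + ?w z) / ?s - 1)" for z
  proof -
    have "random_query_time X (cell_index a b) n z \<le> 18 + 10 * real (floorlog 2 (collisions a b X n z))"
      by (simp add: random_query_time_cell_index[OF a_less_b] of_bool_def)
    \<comment> \<open>\<open>floorlog_le_ln\<close> is multiplied by 10: its 1 raises 18 to 28 and
      its 2 becomes 20.\<close>
    also have "\<dots> \<le> 28 + 20 * ln (1 + ?w z)"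
      using floorlog_le_ln[of "collisions a b X n z"] by simp
    also have "\<dots> \<le> 28 + 20 * (ln ?s + (1 + ?w z) / ?s - 1)"
      using ln_le_tangent[of ?s "1 + ?w z"] s by (intro add_left_mono mult_left_mono) auto
    finally show ?thesis .
  qed
  then have "expected_time M X query_law (cell_index a b) n
      \<le> (LINT z|(M \<Otimes>\<^sub>M query_law). 28 + 20 * (ln ?s + (1 + ?w z) / ?s - 1))"
    unfolding expected_time_def using integrable_collisions
    by (intro integral_mono integrable_random_query_time) auto
  also have "\<dots> = 28 + 20 * (ln ?s + (1 + (LINT z|(M \<Otimes>\<^sub>M query_law). ?w z)) / ?s - 1)"
    using integrable_collisions by (simp add: P.prob_space)
  also have "\<dots> \<le> 28 + 20 * (ln ?s + (1 + ?s) / ?s - 1)"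
    using expectation_collisions_le s by (intro add_mono mult_left_mono diff_mono divide_right_mono) auto
  \<comment> \<open>As \<open>(1 + s) / s - 1 = 1 / s\<close> is at most 1, the constant grows from
    28 to 48.\<close>
  also have "\<dots> \<le> 48 + 20 * ln ?s"
    using s by (simp add: field_simps)
  also have "\<dots> \<le> 48 * (1 + rho a b f)"
    using rho_nonneg by (simp add: rho_def)
  finally show ?thesis .
qed

lemma expected_time_nonneg: "0 \<le> expected_time M X query_law R n"
  unfolding expected_time_def by (intro Bochner_Integration.integral_nonneg) (simp add: random_query_time_def case_prod_beta)

lemma expected_time_bigo: "expected_time M X query_law (cell_index a b) \<in> O(\<lambda>n. 1)"
proof (rule bigoI)
  have "norm (expected_time M X query_law (cell_index a b) n) \<le> 48 * (1 + rho a b f) * norm (1::real)" for n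
    using expected_time_nonneg expected_time_le by simp
  then show "\<forall>\<^sub>F n in sequentially. norm (expected_time M X query_law (cell_index a b) n)
      \<le> 48 * (1 + rho a b f) * norm (1::real)"
    by simp
qed

end

text \<open>For the uniform density \<open>rho\<close> is 0 while every query takes positive time,
  so the uniform bound is in terms of \<open>1 + rho\<close>, with \<open>C\<close> chosen before
  the process and the density. For positive \<open>rho\<close>, \<open>O(rho)\<close> and
  \<open>O(1)\<close> are the same class of functions of \<open>n\<close>.\<close>

theorem theorem1:
  "\<exists>C>0. \<forall>(M :: 'a measure) (X :: nat \<Rightarrow> 'a \<Rightarrow> real) (f :: real \<Rightarrow> real) (a :: real) (b :: real).
     prob_space M \<longrightarrow>
     (\<forall>x. 0 \<le> f x) \<longrightarrow>
     (\<forall>i. distributed M lborel (X i) (\<lambda>x. ennreal (f x))) \<longrightarrow>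
     (\<forall>x. x \<notin> {a..b} \<longrightarrow> f x = 0) \<longrightarrow>
     integrable lborel (\<lambda>x. (f x)\<^sup>2) \<longrightarrow>
     (\<exists>R. index_procedure R \<and>
        (\<forall>n. bdd_above ((\<lambda>A. real (space_overhead (R n A))) ` arrays n)) \<and>
        sup_space R \<in> O(\<lambda>n. real n) \<and>
        (\<forall>n. integrable (M \<Otimes>\<^sub>M density lborel (\<lambda>x. ennreal (f x))) (random_query_time X R n)) \<and>
        (\<forall>n. expected_time M X (density lborel (\<lambda>x. ennreal (f x))) R n \<le> C * (1 + rho a b f)) \<and>
        (rho a b f > 0 \<longrightarrow>
          expected_time M X (density lborel (\<lambda>x. ennreal (f x))) R \<in> O(\<lambda>n. rho a b f)) \<and>
        expected_time M X (density lborel (\<lambda>x. ennreal (f x))) R \<in> O(\<lambda>n. 1))"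
proof (intro exI[of _ "48::real"] conjI allI impI)
  fix M :: "'a measure" and X :: "nat \<Rightarrow> 'a \<Rightarrow> real" and f :: "real \<Rightarrow> real" and a b :: real
  assume "prob_space M" "\<forall>x. 0 \<le> f x" "\<forall>i. distributed M lborel (X i) (\<lambda>x. ennreal (f x))"
    "\<forall>x. x \<notin> {a..b} \<longrightarrow> f x = 0" "integrable lborel (\<lambda>x. (f x)\<^sup>2)"
  then interpret key_process M X f a b
    by (simp add: key_process_def key_process_axioms_def)
  \<comment> \<open>\<open>2 * n + 31\<close> is at most \<open>33 * n\<close> once \<open>n\<close>
    is at least 1.\<close>
  have space: "sup_space (cell_index a b) \<in> O(\<lambda>n. real n)"
    unfolding sup_space_cell_index by (rule bigoI[of _ 33]) (auto intro: eventually_sequentiallyI[of 1])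
  have bdd: "bdd_above ((\<lambda>A. real (space_overhead (cell_index a b n A))) ` arrays n)" for n
    by (auto simp: space_cell_index)
  show "\<exists>R. index_procedure R \<and>
    (\<forall>n. bdd_above ((\<lambda>A. real (space_overhead (R n A))) ` arrays n)) \<and>
    sup_space R \<in> O(\<lambda>n. real n) \<and>
    (\<forall>n. integrable (M \<Otimes>\<^sub>M query_law) (random_query_time X R n)) \<and>
    (\<forall>n. expected_time M X query_law R n \<le> 48 * (1 + rho a b f)) \<and>
    (rho a b f > 0 \<longrightarrow> expected_time M X query_law R \<in> O(\<lambda>n. rho a b f)) \<and>
    expected_time M X query_law R \<in> O(\<lambda>n. 1)"
    using index_procedure_cell_index[OF a_less_b] bdd space integrable_random_query_time
      expected_time_le expected_time_bigo
    by (intro exI[of _ "cell_index a b"]) auto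
qed simp

end
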